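(* Let $V^{ATS}$ denote the optimal value of the adaptive two-stage capacity expansion problem (with revision times as decision variables), let $t^*=(t_1^*,\dots,t_I^* )\in\{1,\dots,T\}^I$ be a given vector of revision times, and let $\{y_n^{MLP}\}_{n\in\mathcal T}$ be the optimal capacity allocation decisions of the linear programming relaxation of the multi-stage stochastic capacity expansion planning problem. Then $$V^{ATS}(t^* )-V^{ATS}\ \le\ \sum_{i=1}^{I}\Big(v_i^R(t_i^* )-v_i^M+\max_{n\in\hat{\mathcal T}_i(t_i^* )}\{\lceil\hat\delta_{in}\rceil-\hat\delta_{in}\}\,a_{i1}\Big),$$ where $\delta_{in}=[A_ny_n^{MLP}]_i$, and $v_i^M$, $v_i^R(t_i^* )$ are the optimal values of the linear programming relaxations of the multi-stage single-resource problem and of the adaptive two-stage single-resource problem with revision time $t_i^*$ for resource $i$ under these $\delta_{in}$.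
   Context: $\mathcal T$ is a scenario tree with $T$ stages: a rooted tree (root denoted 1) whose nodes $n$ have period $t_n\in\{1,\dots,T\}$. $S_t$ is the set of nodes of period $t$; $P(n)$ is the set of nodes on the path from the root to $n$ (inclusive); $\mathcal T(n)$ is the subtree rooted at $n$. $p_n$ is the probability of (reaching) node $n$, with $\sum_{n\in S_t}p_n=1$ for each $t$. Multi-stage stochastic capacity expansion planning problem, with resources $\mathcal I$ ($I=|\mathcal I|$), tasks $\mathcal J$, items $\mathcal K$: $$\min\Big\{\sum_{n\in\mathcal T}p_n(a_n^\top x_n+b_n^\top y_n):\ A_ny_n\le\sum_{m\in P(n)}x_m,\ B_ny_n\ge d_n,\ x_n\in\mathbb Z_+^{|\mathcal I|},\ y_n\in\mathbb R_+^{|\mathcal J|}\ \forall n\in\mathcal T\Big\},$$ with $a_n\in\mathbb R_+^{|\mathcal I|}$, $b_n\in\mathbb R_+^{|\mathcal J|}$, $d_n\in\mathbb R_+^{|\mathcal K|}$; $x_n$ are capacity acquisition decisions and $y_n$ capacity allocation decisions. Adaptive two-stage version with revision decisions $t^*$: add, for each $i$, $x_{im}=x_{in}$ for all $m,n\in S_t$, $t<t_i^*$, and $x_{im}=x_{in}$ for all $m,n\in S_t\cap\mathcal T(j)$, $j\in S_{t_i^*}$, $t\ge t_i^*$; its optimal value is $V^{ATS}(t^* )$. In the adaptive two-stage capacity expansion problem (value $V^{ATS}$) the revision vector $t^*\in\{1,\dots,T\}^I$ is optimized as well. Linear programming relaxations replace $\mathbb Z_+$ by $\mathbb R_+$. Single-resource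 problems for resource $i$ given $\{\delta_{in}\}_{n\in\mathcal T}$: (multi-stage) minimize $\sum_{n\in\mathcal T}p_na_{in}x_{in}$ subject to $\sum_{m\in P(n)}x_{im}\ge\delta_{in}$, $x_{in}\in\mathbb Z_+$ for all $n\in\mathcal T$; (adaptive two-stage) the same with the adaptive constraints for $i$ with $t_i^*$ added. Condensed tree: $\hat{\mathcal T}_i(t_i^* )$ is obtained from $\mathcal T$ by merging nodes forced to have equal $x_i$-decisions by the adaptive constraints: its nodes correspond to the sets $S_t$ for $t<t_i^*$, and $S_t\cap\mathcal T(j)$ for $j\in S_{t_i^*}$, $t\ge t_i^*$. If $\hat C_n\subset\mathcal T$ is the set merged into node $n\in\hat{\mathcal T}_i(t_i^* )$, then $\hat\delta_{in}=\max_{m\in\hat C_n}\delta_{im}$. $[\cdot]_i$ is the $i$-th component of a vector. *)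

theory Defs
  imports "HOL-Analysis.Analysis"
begin

section \<open>Scenario trees\<close>

text \<open>The nodes of a scenario tree are all the elements of the finite type \<open>'n\<close>; an edge
  points from a node to its child.\<close>

record 'n scenario_tree =
  edges :: "('n \<times> 'n) set"
  root_node :: 'n
  period :: "'n \<Rightarrow> nat"
  horizon :: nat
  prob :: "'n \<Rightarrow> real"

definition rooted_tree :: "('n \<times> 'n) set \<Rightarrow> 'n \<Rightarrow> bool" where
  "rooted_tree E r \<longleftrightarrow>
     (\<forall>n. (r, n) \<in> E\<^sup>*) \<and>
     (\<forall>m. (m, r) \<notin> E) \<and>
     (\<forall>l m n. (l, n) \<in> E \<longrightarrow> (m, n) \<in> E \<longrightarrow> l = m)"

definition stage :: "('n, 'z) scenario_tree_scheme \<Rightarrow> nat \<Rightarrow> 'n set" where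
  "stage S t = {n. period S n = t}"

definition path_to :: "('n, 'z) scenario_tree_scheme \<Rightarrow> 'n \<Rightarrow> 'n set" where
  "path_to S n = {m. (m, n) \<in> (edges S)\<^sup>*}"

definition subtree :: "('n, 'z) scenario_tree_scheme \<Rightarrow> 'n \<Rightarrow> 'n set" where
  "subtree S n = {m. (n, m) \<in> (edges S)\<^sup>*}"

definition is_scenario_tree :: "('n::finite, 'z) scenario_tree_scheme \<Rightarrow> bool" where
  "is_scenario_tree S \<longleftrightarrow>
     rooted_tree (edges S) (root_node S) \<and>
     period S (root_node S) = 1 \<and>
     (\<forall>(m, n) \<in> edges S. period S n = period S m + 1) \<and>
     (\<forall>n. period S n \<in> {1..horizon S}) \<and>
     (\<forall>n. prob S n \<ge> 0) \<and>
     (\<forall>t\<in>{1..horizon S}. (\<Sum>n\<in>stage S t. prob S n) = 1)"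

text \<open>The constraints that revision time \<open>t\<close> imposes on the decisions \<open>z\<close> for one resource.\<close>

definition adaptive :: "('n, 'z) scenario_tree_scheme \<Rightarrow> nat \<Rightarrow> ('n \<Rightarrow> real) \<Rightarrow> bool" where
  "adaptive S t z \<longleftrightarrow>
     (\<forall>s<t. \<forall>m\<in>stage S s. \<forall>n\<in>stage S s. z m = z n) \<and>
     (\<forall>s\<ge>t. \<forall>j\<in>stage S t.
        \<forall>m\<in>stage S s \<inter> subtree S j. \<forall>n\<in>stage S s \<inter> subtree S j. z m = z n)"

text \<open>A node of the condensed tree is represented by the set of nodes merged into it.  If a
  branch ends before the horizon, some intersections below are empty; these are not nodes.\<close>

definition condensed_nodes :: "('n, 'z) scenario_tree_scheme \<Rightarrow> nat \<Rightarrow> 'n set set" where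
  "condensed_nodes S t =
     ({stage S s | s. 1 \<le> s \<and> s < t} \<union>
      {stage S s \<inter> subtree S j | s j. t \<le> s \<and> s \<le> horizon S \<and> j \<in> stage S t}) - {{}}"

definition condensed_demand :: "('n \<Rightarrow> real) \<Rightarrow> 'n set \<Rightarrow> real" where
  "condensed_demand \<delta> C = Max (\<delta> ` C)"

section \<open>Capacity expansion problems\<close>

text \<open>In the usual notation the fields are \<open>a\<close>, \<open>b\<close>, \<open>A\<close>, \<open>B\<close> and \<open>d\<close>; the types \<open>'i\<close>, \<open>'j\<close>
  and \<open>'k\<close> index resources, tasks and items.\<close>

record ('n, 'i, 'j, 'k) capacity_problem = "'n scenario_tree" +
  acq_cost :: "'n \<Rightarrow> real ^ 'i"
  alloc_cost :: "'n \<Rightarrow> real ^ 'j"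
  usage :: "'n \<Rightarrow> real ^ 'j ^ 'i"
  yield :: "'n \<Rightarrow> real ^ 'j ^ 'k"
  demand :: "'n \<Rightarrow> real ^ 'k"

definition is_capacity_problem ::
  "('n::finite, 'i::finite, 'j::finite, 'k::finite) capacity_problem \<Rightarrow> bool" where
  "is_capacity_problem C \<longleftrightarrow> is_scenario_tree C \<and>
     (\<forall>n. 0 \<le> acq_cost C n \<and> 0 \<le> alloc_cost C n \<and> 0 \<le> demand C n)"

definition total_cost ::
  "('n::finite, 'i::finite, 'j::finite, 'k::finite) capacity_problem
    \<Rightarrow> ('n \<Rightarrow> real ^ 'i) \<Rightarrow> ('n \<Rightarrow> real ^ 'j) \<Rightarrow> real" where
  "total_cost C x y =
     (\<Sum>n\<in>UNIV. prob C n * (acq_cost C n \<bullet> x n + alloc_cost C n \<bullet> y n))"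

text \<open>Inequalities between vectors are componentwise.\<close>

definition MLP_feasible ::
  "('n::finite, 'i::finite, 'j::finite, 'k::finite) capacity_problem
    \<Rightarrow> ('n \<Rightarrow> real ^ 'i) \<Rightarrow> ('n \<Rightarrow> real ^ 'j) \<Rightarrow> bool" where
  "MLP_feasible C x y \<longleftrightarrow>
     (\<forall>n. usage C n *v y n \<le> (\<Sum>m\<in>path_to C n. x m) \<and>
          yield C n *v y n \<ge> demand C n \<and>
          0 \<le> x n \<and> 0 \<le> y n)"

definition MS_feasible ::
  "('n::finite, 'i::finite, 'j::finite, 'k::finite) capacity_problem
    \<Rightarrow> ('n \<Rightarrow> real ^ 'i) \<Rightarrow> ('n \<Rightarrow> real ^ 'j) \<Rightarrow> bool" where
  "MS_feasible C x y \<longleftrightarrow> MLP_feasible C x y \<and> (\<forall>n i. x n $ i \<in> \<int>)"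

definition ATS_feasible ::
  "('n::finite, 'i::finite, 'j::finite, 'k::finite) capacity_problem \<Rightarrow> ('i \<Rightarrow> nat)
    \<Rightarrow> ('n \<Rightarrow> real ^ 'i) \<Rightarrow> ('n \<Rightarrow> real ^ 'j) \<Rightarrow> bool" where
  "ATS_feasible C t x y \<longleftrightarrow>
     MS_feasible C x y \<and> (\<forall>i. adaptive C (t i) (\<lambda>n. x n $ i))"

definition MLP_optimal ::
  "('n::finite, 'i::finite, 'j::finite, 'k::finite) capacity_problem
    \<Rightarrow> ('n \<Rightarrow> real ^ 'i) \<Rightarrow> ('n \<Rightarrow> real ^ 'j) \<Rightarrow> bool" where
  "MLP_optimal C x y \<longleftrightarrow> MLP_feasible C x y \<and>
     (\<forall>x' y'. MLP_feasible C x' y' \<longrightarrow> total_cost C x y \<le> total_cost C x' y')"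

definition revision_times :: "('n, 'z) scenario_tree_scheme \<Rightarrow> ('i \<Rightarrow> nat) set" where
  "revision_times S = {t. \<forall>i. t i \<in> {1..horizon S}}"

text \<open>Optimal values are infima of the attainable costs, so no attainment is presupposed.
  All costs are nonnegative.  Moreover, once the linear relaxation is feasible, so are all the
  problems below (acquire enough capacity at the root); hence the infima are those of
  nonempty sets that are bounded below.\<close>

definition V_ATS ::
  "('n::finite, 'i::finite, 'j::finite, 'k::finite) capacity_problem \<Rightarrow> ('i \<Rightarrow> nat) \<Rightarrow> real" where
  "V_ATS C t = Inf {total_cost C x y | x y. ATS_feasible C t x y}"

definition V_ATS_opt ::
  "('n::finite, 'i::finite, 'j::finite, 'k::finite) capacity_problem \<Rightarrow> real" where
  "V_ATS_opt C =
     Inf {total_cost C x y | t x y. t \<in> revision_times C \<and> ATS_feasible C t x y}"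

section \<open>Linear relaxations of the single-resource problems\<close>

text \<open>Here \<open>c\<close> and \<open>\<delta>\<close> are the acquisition costs and the required capacities of one resource.\<close>

definition single_cost ::
  "('n::finite, 'z) scenario_tree_scheme \<Rightarrow> ('n \<Rightarrow> real) \<Rightarrow> ('n \<Rightarrow> real) \<Rightarrow> real" where
  "single_cost S c z = (\<Sum>n\<in>UNIV. prob S n * c n * z n)"

definition single_LP_feasible ::
  "('n::finite, 'z) scenario_tree_scheme \<Rightarrow> ('n \<Rightarrow> real) \<Rightarrow> ('n \<Rightarrow> real) \<Rightarrow> bool" where
  "single_LP_feasible S \<delta> z \<longleftrightarrow> (\<forall>n. (\<Sum>m\<in>path_to S n. z m) \<ge> \<delta> n \<and> z n \<ge> 0)"

definition v_M ::
  "('n::finite, 'z) scenario_tree_scheme \<Rightarrow> ('n \<Rightarrow> real) \<Rightarrow> ('n \<Rightarrow> real) \<Rightarrow> real" where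
  "v_M S c \<delta> = Inf {single_cost S c z | z. single_LP_feasible S \<delta> z}"

definition v_R ::
  "('n::finite, 'z) scenario_tree_scheme \<Rightarrow> ('n \<Rightarrow> real) \<Rightarrow> ('n \<Rightarrow> real) \<Rightarrow> nat \<Rightarrow> real" where
  "v_R S c \<delta> t = Inf {single_cost S c z | z. single_LP_feasible S \<delta> z \<and> adaptive S t z}"

end

theory Submission
  imports Defs
begin

text \<open>Once the allocation is frozen at \<open>yMLP\<close>, the problem with revision times \<open>t\<close> splits into
  one integer program per resource, and so \<open>V_ATS C t\<close> is at most the allocation cost of \<open>yMLP\<close>
  plus the values of these programs.  In the other direction, every adaptive plan is feasible for
  the linear relaxation of the multi-stage problem, whose optimum \<open>(xMLP, yMLP)\<close> has the same
  allocation cost and, for each resource, an acquisition cost of at least \<open>v_M\<close>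
  (\<open>v_M_le\<close>).  In the difference the allocation cost cancels.

  It remains to bound the integer program of one resource by its relaxation \<open>v_R\<close> plus the
  price at the root of the largest rounding gap \<open>\<theta> = max \<lceil>\<delta>\<rceil> - \<delta>\<close> over the condensed demands
  (\<open>integral_plan_from_relaxation\<close>).  The capacity available under an adaptive plan
  is constant on every condensed node (\<open>capacity_adaptive\<close>), hence it covers the condensed demand
  there.  After buying \<open>\<theta>\<close> more at the root, which has probability 1, it covers the
  condensed demand rounded up, an integer.

  The resulting plan \<open>z\<close>, with cumulative capacity \<open>X\<close>, is made integral by a random shift:
  for \<open>u\<close> in the unit interval, let the cumulative capacity be \<open>\<lfloor>X n + u\<rfloor> - \<lfloor>u\<rfloor>\<close>.
  This is still at least any integer that \<open>X n\<close> reaches.  The increments are nonnegative integers, and they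
  are adaptive because \<open>X\<close> and \<open>z\<close> are.  As \<open>\<lfloor>x + u\<rfloor>\<close> has mean \<open>x\<close>
  (\<open>has_integral_floor_shift\<close>), the expected increments are those of \<open>z\<close>, and some
  shift costs no more than \<open>z\<close> up to an arbitrarily small error, which the infima absorb.  This
  takes the place of the total unimodularity of path constraints on a tree.\<close>

section \<open>Paths and periods in a scenario tree\<close>

lemma scenario_tree_induct [consumes 1, case_names root child]:
  fixes S :: "('n::finite, 'z) scenario_tree_scheme"
  assumes "is_scenario_tree S"
    and "P (root_node S)"
    and "\<And>p n. (p, n) \<in> edges S \<Longrightarrow> P p \<Longrightarrow> P n"
  shows "P n"
proof -
  have "(root_node S, n) \<in> (edges S)\<^sup>*"
    using assms(1) by (simp add: is_scenario_tree_def rooted_tree_def)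
  then show ?thesis
    by (induction rule: rtrancl_induct) (use assms in auto)
qed

lemma node_cases:
  fixes S :: "('n::finite, 'z) scenario_tree_scheme"
  assumes "is_scenario_tree S"
  obtains "n = root_node S" | p where "(p, n) \<in> edges S"
  using scenario_tree_induct[OF assms, where P = "\<lambda>n. n = root_node S \<or> (\<exists>p. (p, n) \<in> edges S)"]
  by blast

lemma period_child:
  fixes S :: "('n::finite, 'z) scenario_tree_scheme"
  assumes "is_scenario_tree S" "(p, n) \<in> edges S"
  shows "period S n = Suc (period S p)"
  using assms unfolding is_scenario_tree_def by fastforce

lemma period_root:
  fixes S :: "('n::finite, 'z) scenario_tree_scheme"
  assumes "is_scenario_tree S"
  shows "period S (root_node S) = 1"
  using assms by (simp add: is_scenario_tree_def)

lemma period_ge_1: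
  fixes S :: "('n::finite, 'z) scenario_tree_scheme"
  assumes "is_scenario_tree S"
  shows "1 \<le> period S n"
  using assms by (auto simp: is_scenario_tree_def)

lemma period_eq_1_iff:
  fixes S :: "('n::finite, 'z) scenario_tree_scheme"
  assumes "is_scenario_tree S"
  shows "period S n = 1 \<longleftrightarrow> n = root_node S"
proof (cases rule: node_cases[OF assms, of n])
  case 1
  then show ?thesis using period_root[OF assms] by simp
next
  case (2 p)
  then show ?thesis
    using period_child[OF assms 2] period_ge_1[OF assms, of p] period_root[OF assms] by auto
qed

lemma parent_unique:
  fixes S :: "('n::finite, 'z) scenario_tree_scheme"
  assumes "is_scenario_tree S" "(l, n) \<in> edges S" "(p, n) \<in> edges S"
  shows "l = p"
  using assms unfolding is_scenario_tree_def rooted_tree_def by blast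

lemma period_mono:
  fixes S :: "('n::finite, 'z) scenario_tree_scheme"
  assumes "is_scenario_tree S" "(m, n) \<in> (edges S)\<^sup>*"
  shows "period S m \<le> period S n"
  using assms(2) by induction (auto dest: period_child[OF assms(1)])

lemma subtree_cases:
  fixes S :: "('n::finite, 'z) scenario_tree_scheme"
  assumes "is_scenario_tree S" "n \<in> subtree S j"
  obtains "n = j" | p where "(p, n) \<in> edges S" "p \<in> subtree S j"
  using assms(2) unfolding subtree_def by (auto elim: rtranclE)

lemma path_to_root:
  fixes S :: "('n::finite, 'z) scenario_tree_scheme"
  assumes "is_scenario_tree S"
  shows "path_to S (root_node S) = {root_node S}"
  using assms unfolding path_to_def is_scenario_tree_def rooted_tree_def
  by (auto elim: rtranclE)

lemma path_to_child:
  fixes S :: "('n::finite, 'z) scenario_tree_scheme"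
  assumes "is_scenario_tree S" "(p, n) \<in> edges S"
  shows "path_to S n = insert n (path_to S p)" "n \<notin> path_to S p"
proof -
  show "path_to S n = insert n (path_to S p)"
  proof (intro equalityI subsetI)
    fix m assume "m \<in> path_to S n"
    then show "m \<in> insert n (path_to S p)"
      unfolding path_to_def using parent_unique[OF assms(1) _ assms(2)]
      by (metis insertCI mem_Collect_eq rtranclE)
  next
    fix m assume "m \<in> insert n (path_to S p)"
    then show "m \<in> path_to S n"
      unfolding path_to_def using rtrancl_into_rtrancl[OF _ assms(2)] by blast
  qed
  show "n \<notin> path_to S p"
    using period_mono[OF assms(1), of n p] period_child[OF assms] by (auto simp: path_to_def)
qed

section \<open>Cumulative capacity\<close>

definition capacity :: "('n, 'z) scenario_tree_scheme \<Rightarrow> ('n \<Rightarrow> real) \<Rightarrow> 'n \<Rightarrow> real" where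
  "capacity S z n = (\<Sum>m\<in>path_to S n. z m)"

lemma capacity_root:
  fixes S :: "('n::finite, 'z) scenario_tree_scheme"
  assumes "is_scenario_tree S"
  shows "capacity S z (root_node S) = z (root_node S)"
  by (simp add: capacity_def path_to_root[OF assms])

lemma capacity_child:
  fixes S :: "('n::finite, 'z) scenario_tree_scheme"
  assumes "is_scenario_tree S" "(p, n) \<in> edges S"
  shows "capacity S z n = z n + capacity S z p"
  using path_to_child[OF assms] by (simp add: capacity_def)

lemma capacity_add_at_root:
  fixes S :: "('n::finite, 'z) scenario_tree_scheme"
  assumes "is_scenario_tree S"
  shows "capacity S (\<lambda>n. z n + (if n = root_node S then \<theta> else 0)) n = capacity S z n + \<theta>"
proof -
  have "root_node S \<in> path_to S n"
    using assms by (simp add: is_scenario_tree_def rooted_tree_def path_to_def)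
  then show ?thesis
    by (simp add: capacity_def sum.distrib)
qed

lemma stage_1:
  fixes S :: "('n::finite, 'z) scenario_tree_scheme"
  assumes "is_scenario_tree S"
  shows "stage S 1 = {root_node S}"
  using period_eq_1_iff[OF assms] by (auto simp: stage_def)

lemma prob_root:
  fixes S :: "('n::finite, 'z) scenario_tree_scheme"
  assumes "is_scenario_tree S"
  shows "prob S (root_node S) = 1"
proof -
  have "1 \<in> {1..horizon S}"
    using assms period_root[OF assms] unfolding is_scenario_tree_def by (metis atLeastAtMost_iff)
  then have "(\<Sum>n\<in>stage S 1. prob S n) = 1"
    using assms unfolding is_scenario_tree_def by blast
  then show ?thesis by (simp only: stage_1[OF assms]) simp
qed

lemma single_cost_add_at_root:
  fixes S :: "('n::finite, 'z) scenario_tree_scheme"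
  assumes "is_scenario_tree S"
  shows "single_cost S c (\<lambda>n. z n + (if n = root_node S then \<theta> else 0))
    = single_cost S c z + \<theta> * c (root_node S)"
proof -
  have "single_cost S c (\<lambda>n. z n + (if n = root_node S then \<theta> else 0))
    = (\<Sum>n\<in>UNIV. prob S n * c n * z n
        + (if n = root_node S then prob S n * c n * \<theta> else 0))"
    unfolding single_cost_def by (intro sum.cong) (auto simp: algebra_simps)
  also have "\<dots> = single_cost S c z + \<theta> * c (root_node S)"
    by (simp add: single_cost_def sum.distrib prob_root[OF assms])
  finally show ?thesis .
qed

section \<open>Nodes that the adaptive constraints merge\<close>

text \<open>This needs \<open>1 \<le> t\<close>: with \<open>t = 0\<close> no node has period \<open>t\<close>, and there are no
  condensed nodes at all.\<close>

lemma condensed_node_exists: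
  fixes S :: "('n::finite, 'z) scenario_tree_scheme"
  assumes tree: "is_scenario_tree S" and "1 \<le> t"
  obtains D where "D \<in> condensed_nodes S t" "n \<in> D"
proof (cases "period S n < t")
  case True
  then have "stage S (period S n) \<in> condensed_nodes S t" "n \<in> stage S (period S n)"
    using period_ge_1[OF tree, of n] by (auto simp: condensed_nodes_def stage_def)
  then show ?thesis using that by blast
next
  case False
  have "t \<le> period S n \<longrightarrow> (\<exists>j\<in>stage S t. n \<in> subtree S j)"
  proof (induction rule: scenario_tree_induct[OF tree])
    case 1
    then show ?case
      using \<open>1 \<le> t\<close> period_root[OF tree] by (auto simp: stage_def subtree_def)
  next
    case (2 p n)
    show ?case
    proof
      assume "t \<le> period S n"
      then consider "period S n = t" | "t \<le> period S p"
        using period_child[OF tree 2(1)] by linarith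
      then show "\<exists>j\<in>stage S t. n \<in> subtree S j"
      proof cases
        case 1
        then show ?thesis by (auto simp: stage_def subtree_def)
      next
        case p: 2
        then show ?thesis
          using 2 by (auto simp: subtree_def intro: rtrancl_into_rtrancl)
      qed
    qed
  qed
  then obtain j where j: "j \<in> stage S t" "n \<in> subtree S j"
    using False by auto
  have "period S n \<le> horizon S"
    using tree by (auto simp: is_scenario_tree_def)
  moreover have n: "n \<in> stage S (period S n) \<inter> subtree S j"
    using j by (simp add: stage_def)
  ultimately have "stage S (period S n) \<inter> subtree S j \<in> condensed_nodes S t"
    using j False unfolding condensed_nodes_def by force
  then show ?thesis using that n by blast
qed

text \<open>A relation between nodes suits induction along the tree better than the quantifiers over
  periods and subtrees in \<^const>\<open>adaptive\<close>: it passes from two nodes to their parents.\<close>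

definition merged :: "('n, 'z) scenario_tree_scheme \<Rightarrow> nat \<Rightarrow> 'n \<Rightarrow> 'n \<Rightarrow> bool" where
  "merged S t m n \<longleftrightarrow> period S m = period S n \<and>
     (t \<le> period S m \<longrightarrow> (\<exists>j\<in>stage S t. m \<in> subtree S j \<and> n \<in> subtree S j))"

lemma adaptive_iff_merged:
  "adaptive S t z \<longleftrightarrow> (\<forall>m n. merged S t m n \<longrightarrow> z m = z n)"
proof
  assume z: "adaptive S t z"
  show "\<forall>m n. merged S t m n \<longrightarrow> z m = z n"
  proof (intro allI impI)
    fix m n
    assume mn: "merged S t m n"
    then have stage: "m \<in> stage S (period S m)" "n \<in> stage S (period S m)"
      by (simp_all add: merged_def stage_def)
    show "z m = z n"
    proof (cases "period S m < t")
      case True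
      then show ?thesis using z stage unfolding adaptive_def by blast
    next
      case False
      then have "t \<le> period S m" by simp
      moreover obtain j where "j \<in> stage S t" "m \<in> subtree S j" "n \<in> subtree S j"
        using mn False by (auto simp: merged_def)
      ultimately show ?thesis using z stage unfolding adaptive_def by blast
    qed
  qed
next
  assume z: "\<forall>m n. merged S t m n \<longrightarrow> z m = z n"
  have "z m = z n" if "s < t" "m \<in> stage S s" "n \<in> stage S s" for s m n
  proof -
    have "merged S t m n" using that by (simp add: merged_def stage_def)
    then show ?thesis using z by blast
  qed
  moreover have "z m = z n" if "t \<le> s" "j \<in> stage S t" "m \<in> stage S s \<inter> subtree S j"
    "n \<in> stage S s \<inter> subtree S j" for s j m n
  proof -
    have "period S m = period S n" using that by (simp add: stage_def)
    then have "merged S t m n" using that unfolding merged_def by blast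
    then show ?thesis using z by blast
  qed
  ultimately show "adaptive S t z"
    unfolding adaptive_def by blast
qed

lemma merged_if_condensed_node:
  assumes "D \<in> condensed_nodes S t" "m \<in> D" "n \<in> D"
  shows "merged S t m n"
  using assms unfolding condensed_nodes_def merged_def stage_def by fastforce

lemma merged_root_iff:
  fixes S :: "('n::finite, 'z) scenario_tree_scheme"
  assumes "is_scenario_tree S" "merged S t m n"
  shows "m = root_node S \<longleftrightarrow> n = root_node S"
  using assms(2) period_eq_1_iff[OF assms(1)] unfolding merged_def by metis

text \<open>Two merged nodes whose parents are at the revision period or later lie strictly below the
  common node \<open>j\<close> of that period, so both paths from \<open>j\<close> run through the parents.\<close>

lemma merged_parents:
  fixes S :: "('n::finite, 'z) scenario_tree_scheme"
  assumes tree: "is_scenario_tree S" and mn: "merged S t m n"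
    and edges: "(p, m) \<in> edges S" "(q, n) \<in> edges S"
  shows "merged S t p q"
proof -
  have per: "period S m = Suc (period S p)" "period S n = Suc (period S q)"
    using period_child[OF tree] edges by blast+
  have "\<exists>j\<in>stage S t. p \<in> subtree S j \<and> q \<in> subtree S j" if "t \<le> period S p"
  proof -
    have "t \<le> period S m"
      using that per by simp
    then obtain j where j: "j \<in> stage S t" "m \<in> subtree S j" "n \<in> subtree S j"
      using mn unfolding merged_def by blast
    then have "m \<noteq> j" "n \<noteq> j"
      using that per mn by (auto simp: merged_def stage_def)
    then have "p \<in> subtree S j" "q \<in> subtree S j"
      using j edges subtree_cases[OF tree] parent_unique[OF tree] by metis+
    then show ?thesis using j by blast
  qed
  then show ?thesis
    using mn per by (auto simp: merged_def)
qed

text \<open>Walking back from two merged nodes to the root meets merged pairs all the way, so both paths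
  collect the same acquisitions.  This is why the condensed tree is never needed as a tree: its
  path sums are those of the original tree.\<close>

lemma capacity_adaptive:
  fixes S :: "('n::finite, 'z) scenario_tree_scheme"
  assumes tree: "is_scenario_tree S" and "adaptive S t z"
  shows "adaptive S t (capacity S z)"
proof -
  have z: "z m = z n" if "merged S t m n" for m n
    using assms(2) that by (simp add: adaptive_iff_merged)
  have "\<forall>n. merged S t m n \<longrightarrow> capacity S z m = capacity S z n" for m
  proof (induction rule: scenario_tree_induct[OF tree])
    case 1
    then show ?case
      using merged_root_iff[OF tree] by blast
  next
    case (2 p m)
    show ?case
    proof (intro allI impI)
      fix n
      assume mn: "merged S t m n"
      then have "period S n = Suc (period S p)"
        using period_child[OF tree 2(1)] by (simp add: merged_def)
      then have "n \<noteq> root_node S"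
        using period_ge_1[OF tree, of p] period_root[OF tree] by auto
      then obtain q where q: "(q, n) \<in> edges S"
        using node_cases[OF tree] by blast
      then show "capacity S z m = capacity S z n"
        using 2 z[OF mn] merged_parents[OF tree mn 2(1) q] capacity_child[OF tree] by metis
    qed
  qed
  then show ?thesis by (simp add: adaptive_iff_merged)
qed

section \<open>Integral plans by a random shift\<close>

text \<open>Here \<open>capacity S z n - z n\<close> is the capacity at the parent of \<open>n\<close>, and it is 0 at the root.
  This form treats the root like all other nodes.\<close>

definition rounded :: "('n, 'z) scenario_tree_scheme \<Rightarrow> ('n \<Rightarrow> real) \<Rightarrow> real \<Rightarrow> 'n \<Rightarrow> real" where
  "rounded S z u n = of_int (\<lfloor>capacity S z n + u\<rfloor> - \<lfloor>capacity S z n - z n + u\<rfloor>)"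

text \<open>The sum along a path telescopes.\<close>

lemma capacity_rounded:
  fixes S :: "('n::finite, 'z) scenario_tree_scheme"
  assumes tree: "is_scenario_tree S"
  shows "capacity S (rounded S z u) n = of_int (\<lfloor>capacity S z n + u\<rfloor> - \<lfloor>u\<rfloor>)"
  by (induction rule: scenario_tree_induct[OF tree])
    (simp_all add: rounded_def capacity_root[OF tree] capacity_child[OF tree])

lemma rounded_nonneg:
  assumes "0 \<le> z n"
  shows "0 \<le> rounded S z u n"
  using assms by (simp add: rounded_def floor_mono)

lemma rounded_adaptive:
  fixes S :: "('n::finite, 'z) scenario_tree_scheme"
  assumes "is_scenario_tree S" "adaptive S t z"
  shows "adaptive S t (rounded S z u)"
  using assms(2) capacity_adaptive[OF assms] by (simp add: adaptive_iff_merged rounded_def)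

text \<open>\<open>\<lfloor>x + u\<rfloor>\<close> exceeds \<open>\<lfloor>x\<rfloor>\<close> by 1 exactly when \<open>u \<ge> 1 - frac x\<close>, an event of
  probability \<^term>\<open>frac x\<close>.\<close>

lemma has_integral_floor_shift:
  "((\<lambda>u. of_int \<lfloor>x + u\<rfloor>) has_integral x) {0..1::real}"
proof -
  have "((\<lambda>u. 1::real) has_integral frac x) {1 - frac x..1}"
    using has_integral_const_real[of "1::real" "1 - frac x" 1] by (simp add: frac_ge_0)
  then have "((\<lambda>u. if u \<in> {1 - frac x..1} then 1 else 0 :: real) has_integral frac x) {0..1}"
    by (subst has_integral_restrict) (use frac_lt_1[of x] in auto)
  moreover have "((\<lambda>u. real_of_int \<lfloor>x\<rfloor>) has_integral of_int \<lfloor>x\<rfloor>) {0..1::real}"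
    using has_integral_const_real[of "of_int \<lfloor>x\<rfloor> :: real" 0 1] by simp
  ultimately have "((\<lambda>u. (if u \<in> {1 - frac x..1} then 1 else 0 :: real) + of_int \<lfloor>x\<rfloor>)
      has_integral frac x + of_int \<lfloor>x\<rfloor>) {0..1}"
    by (rule has_integral_add)
  moreover have "(if u \<in> {1 - frac x..1} then 1 else 0 :: real) + of_int \<lfloor>x\<rfloor> = of_int \<lfloor>x + u\<rfloor>"
    if "u \<in> {0..1}" for u
  proof (cases "1 - frac x \<le> u")
    case True
    then have "\<lfloor>x + u\<rfloor> = \<lfloor>x\<rfloor> + 1"
      using that frac_lt_1[of x] unfolding floor_eq_iff by (auto simp: frac_def)
    then show ?thesis using True that by simp
  next
    case False
    then have "\<lfloor>x + u\<rfloor> = \<lfloor>x\<rfloor>"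
      using that unfolding floor_eq_iff by (auto simp: frac_def; linarith)
    then show ?thesis using False by simp
  qed
  ultimately have "((\<lambda>u. of_int \<lfloor>x + u\<rfloor>) has_integral frac x + of_int \<lfloor>x\<rfloor>) {0..1::real}"
    by (rule has_integral_eq[rotated])
  then show ?thesis by (simp add: frac_def)
qed

lemma has_integral_rounded:
  "((\<lambda>u. rounded S z u n) has_integral z n) {0..1}"
  using has_integral_diff[OF has_integral_floor_shift[of "capacity S z n"]
      has_integral_floor_shift[of "capacity S z n - z n"]]
  by (simp add: rounded_def)

text \<open>By linearity the mean cost over all shifts is the cost of \<open>z\<close>, so they cannot all cost
  at least \<open>\<epsilon>\<close> more.\<close>

lemma exists_cheap_rounding:
  fixes S :: "('n::finite, 'z) scenario_tree_scheme"
  assumes "0 < \<epsilon>"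
  obtains u where "single_cost S c (rounded S z u) < single_cost S c z + \<epsilon>"
proof (rule ccontr)
  assume "\<not> thesis"
  then have "\<And>u. single_cost S c z + \<epsilon> \<le> single_cost S c (rounded S z u)"
    using that by (meson not_less)
  moreover have "((\<lambda>u. single_cost S c (rounded S z u)) has_integral single_cost S c z) {0..1}"
    unfolding single_cost_def
    by (intro has_integral_sum has_integral_mult_right has_integral_rounded) simp
  moreover have "((\<lambda>u. single_cost S c z + \<epsilon>) has_integral single_cost S c z + \<epsilon>) {0..1::real}"
    using has_integral_const_real[of "single_cost S c z + \<epsilon>" 0 1] by simp
  ultimately have "single_cost S c z + \<epsilon> \<le> single_cost S c z"
    by (meson has_integral_le)
  then show False using assms by simp
qed

section \<open>From the relaxation to an integral adaptive plan\<close>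

definition max_rounding_gap :: "('n, 'z) scenario_tree_scheme \<Rightarrow> ('n \<Rightarrow> real) \<Rightarrow> nat \<Rightarrow> real" where
  "max_rounding_gap S \<delta> t =
     Max ((\<lambda>D. of_int \<lceil>condensed_demand \<delta> D\<rceil> - condensed_demand \<delta> D) ` condensed_nodes S t)"

lemma max_rounding_gap_ge:
  fixes S :: "('n::finite, 'z) scenario_tree_scheme"
  assumes "D \<in> condensed_nodes S t"
  shows "of_int \<lceil>condensed_demand \<delta> D\<rceil> - condensed_demand \<delta> D \<le> max_rounding_gap S \<delta> t"
  using assms by (auto simp: max_rounding_gap_def intro!: Max_ge)

lemma max_rounding_gap_nonneg:
  fixes S :: "('n::finite, 'z) scenario_tree_scheme"
  assumes "is_scenario_tree S" "1 \<le> t"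
  shows "0 \<le> max_rounding_gap S \<delta> t"
proof -
  obtain D where "D \<in> condensed_nodes S t"
    using condensed_node_exists[OF assms] by blast
  then show ?thesis
    using max_rounding_gap_ge[of D S t \<delta>] by linarith
qed

text \<open>The integer is the condensed demand, rounded up, of the condensed node containing \<open>n\<close>.
  An integer between the demand and the capacity is what survives rounding the capacity down.\<close>

lemma capacity_covers_rounded_demand:
  fixes S :: "('n::finite, 'z) scenario_tree_scheme"
  assumes tree: "is_scenario_tree S" and t: "1 \<le> t"
    and z: "\<And>n. \<delta> n \<le> capacity S z n" "adaptive S t z"
  obtains k :: int where "\<delta> n \<le> of_int k" "of_int k \<le> capacity S z n + max_rounding_gap S \<delta> t"
proof -
  obtain D where D: "D \<in> condensed_nodes S t" "n \<in> D"
    using condensed_node_exists[OF tree t] by blast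
  have "\<delta> m \<le> capacity S z n" if "m \<in> D" for m
  proof -
    have "capacity S z m = capacity S z n"
      using capacity_adaptive[OF tree z(2)] merged_if_condensed_node[OF D(1) that D(2)]
      unfolding adaptive_iff_merged by blast
    then show ?thesis using z(1)[of m] by simp
  qed
  then have "condensed_demand \<delta> D \<le> capacity S z n"
    using D(2) unfolding condensed_demand_def by (subst Max_le_iff) auto
  moreover have "\<delta> n \<le> condensed_demand \<delta> D"
    using D by (simp add: condensed_demand_def)
  ultimately show ?thesis
    using that[of "\<lceil>condensed_demand \<delta> D\<rceil>"] max_rounding_gap_ge[OF D(1), of \<delta>] by linarith
qed

lemma integral_plan_from_relaxation:
  fixes S :: "('n::finite, 'z) scenario_tree_scheme"
  assumes tree: "is_scenario_tree S" and t: "1 \<le> t" and "0 < \<epsilon>"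
    and z: "single_LP_feasible S \<delta> z" "adaptive S t z"
  obtains w where "single_LP_feasible S \<delta> w" "adaptive S t w" "\<And>n. w n \<in> \<int>"
    "single_cost S c w < single_cost S c z + max_rounding_gap S \<delta> t * c (root_node S) + \<epsilon>"
proof -
  define z' where "z' n = z n + (if n = root_node S then max_rounding_gap S \<delta> t else 0)" for n
  have cap: "capacity S z' n = capacity S z n + max_rounding_gap S \<delta> t" for n
    unfolding z'_def by (rule capacity_add_at_root[OF tree])
  have demand: "\<delta> n \<le> capacity S z n" for n
    using z(1) by (simp add: single_LP_feasible_def capacity_def)
  have "0 \<le> z' n" for n
    using z(1) max_rounding_gap_nonneg[OF tree t]
    by (simp add: z'_def single_LP_feasible_def)
  \<comment> \<open>The root is the only node of its period, so it is merged with no other node.\<close>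
  have adaptive: "adaptive S t z'"
    using z(2) by (auto simp: adaptive_iff_merged z'_def dest: merged_root_iff[OF tree])
  obtain u where u: "single_cost S c (rounded S z' u) < single_cost S c z' + \<epsilon>"
    using exists_cheap_rounding[OF \<open>0 < \<epsilon>\<close>] .
  have "\<delta> n \<le> capacity S (rounded S z' u) n" for n
  proof -
    obtain k :: int where k: "\<delta> n \<le> of_int k" "of_int k \<le> capacity S z' n"
      using capacity_covers_rounded_demand[OF tree t demand z(2)] cap by metis
    have "k + \<lfloor>u\<rfloor> \<le> \<lfloor>capacity S z' n + u\<rfloor>"
      using k(2) by (simp add: le_floor_iff add_mono)
    then show ?thesis
      using k(1) by (simp add: capacity_rounded[OF tree])
  qed
  then have "single_LP_feasible S \<delta> (rounded S z' u)"
    using rounded_nonneg[of z' _ S, OF \<open>\<And>n. 0 \<le> z' n\<close>] by (simp add: single_LP_feasible_def capacity_def)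
  moreover have "rounded S z' u n \<in> \<int>" for n
    unfolding rounded_def by (rule Ints_of_int)
  moreover have "single_cost S c z' = single_cost S c z + max_rounding_gap S \<delta> t * c (root_node S)"
    unfolding z'_def by (rule single_cost_add_at_root[OF tree])
  ultimately show ?thesis
    using that rounded_adaptive[OF tree adaptive] u by metis
qed

text \<open>Acquiring at the root all that is ever required is adaptive.  Thus the infimum in \<^const>\<open>v_R\<close>
  is over a nonempty set and can be approached.\<close>

lemma adaptive_relaxation_feasible:
  fixes S :: "('n::finite, 'z) scenario_tree_scheme"
  assumes tree: "is_scenario_tree S"
  obtains z where "single_LP_feasible S \<delta> z" "adaptive S t z"
proof -
  define M where "M = Max (insert 0 (range \<delta>))"
  define z where "z n = 0 + (if n = root_node S then M else 0)" for n
  have M: "0 \<le> M" "\<delta> n \<le> M" for n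
    unfolding M_def by (rule Max_ge; simp)+
  have "capacity S z n = M" for n
    unfolding z_def capacity_add_at_root[OF tree] by (simp add: capacity_def)
  then have "single_LP_feasible S \<delta> z"
    using M by (simp add: single_LP_feasible_def capacity_def) (simp add: z_def)
  moreover have "adaptive S t z"
    by (auto simp: adaptive_iff_merged z_def dest: merged_root_iff[OF tree])
  ultimately show ?thesis using that by blast
qed

lemma integral_plan_near_v_R:
  fixes S :: "('n::finite, 'z) scenario_tree_scheme"
  assumes tree: "is_scenario_tree S" and t: "1 \<le> t" and "0 < \<epsilon>"
  obtains w where "single_LP_feasible S \<delta> w" "adaptive S t w" "\<And>n. w n \<in> \<int>"
    "single_cost S c w < v_R S c \<delta> t + max_rounding_gap S \<delta> t * c (root_node S) + \<epsilon>"
proof -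
  define X where "X = {single_cost S c z | z. single_LP_feasible S \<delta> z \<and> adaptive S t z}"
  have "X \<noteq> {}"
    unfolding X_def using adaptive_relaxation_feasible[OF tree] by blast
  moreover have "Inf X < v_R S c \<delta> t + \<epsilon> / 2"
    using \<open>0 < \<epsilon>\<close> by (simp add: v_R_def X_def)
  ultimately obtain v where "v \<in> X" "v < v_R S c \<delta> t + \<epsilon> / 2"
    using cInf_lessD by blast
  then obtain z where z: "single_LP_feasible S \<delta> z" "adaptive S t z"
    "single_cost S c z < v_R S c \<delta> t + \<epsilon> / 2"
    unfolding X_def by blast
  show ?thesis
    by (rule integral_plan_from_relaxation[OF tree t _ z(1,2), of "\<epsilon> / 2" c])
      (use z(3) \<open>0 < \<epsilon>\<close> that in force)+
qed

lemma v_M_le: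
  fixes S :: "('n::finite, 'z) scenario_tree_scheme"
  assumes "is_scenario_tree S" "\<And>n. 0 \<le> c n" "single_LP_feasible S \<delta> z"
  shows "v_M S c \<delta> \<le> single_cost S c z"
  unfolding v_M_def
proof (rule cInf_lower)
  have "0 \<le> single_cost S c z'" if "single_LP_feasible S \<delta> z'" for z'
    using assms(1,2) that unfolding single_cost_def single_LP_feasible_def is_scenario_tree_def
    by (intro sum_nonneg mult_nonneg_nonneg) auto
  then show "bdd_below {single_cost S c z | z. single_LP_feasible S \<delta> z}"
    by (intro bdd_belowI[of _ 0]) blast
qed (use assms(3) in blast)

section \<open>Decomposition by resources\<close>

lemma total_cost_split:
  "total_cost C x y =
    (\<Sum>i\<in>UNIV. single_cost C (\<lambda>n. acq_cost C n $ i) (\<lambda>n. x n $ i))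
    + (\<Sum>n\<in>UNIV. prob C n * (alloc_cost C n \<bullet> y n))"
proof -
  have "(\<Sum>i\<in>UNIV. single_cost C (\<lambda>n. acq_cost C n $ i) (\<lambda>n. x n $ i))
    = (\<Sum>n\<in>UNIV. \<Sum>i\<in>UNIV. prob C n * acq_cost C n $ i * x n $ i)"
    unfolding single_cost_def by (rule sum.swap)
  also have "\<dots> = (\<Sum>n\<in>UNIV. prob C n * (acq_cost C n \<bullet> x n))"
    by (simp add: inner_vec_def sum_distrib_left mult.assoc)
  finally show ?thesis
    by (simp add: total_cost_def distrib_left sum.distrib)
qed

lemma MLP_feasible_iff:
  "MLP_feasible C x y \<longleftrightarrow>
    (\<forall>i. single_LP_feasible C (\<lambda>n. (usage C n *v y n) $ i) (\<lambda>n. x n $ i)) \<and>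
    (\<forall>n. demand C n \<le> yield C n *v y n \<and> 0 \<le> y n)"
  unfolding MLP_feasible_def single_LP_feasible_def less_eq_vec_def by auto

lemma inner_vec_nonneg:
  fixes v w :: "real ^ 'm::finite"
  assumes "0 \<le> v" "0 \<le> w"
  shows "0 \<le> v \<bullet> w"
  using assms by (auto simp: inner_vec_def less_eq_vec_def intro!: sum_nonneg)

lemma total_cost_nonneg:
  assumes "is_capacity_problem C" "MLP_feasible C x y"
  shows "0 \<le> total_cost C x y"
proof -
  have "0 \<le> prob C n" "0 \<le> acq_cost C n" "0 \<le> alloc_cost C n" "0 \<le> x n" "0 \<le> y n" for n
    using assms by (auto simp: is_capacity_problem_def is_scenario_tree_def MLP_feasible_def)
  then show ?thesis
    unfolding total_cost_def
    by (intro sum_nonneg mult_nonneg_nonneg add_nonneg_nonneg inner_vec_nonneg)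
qed


section \<open>The optimality gap of given revision times\<close>

theorem corollary2:
  fixes C :: "('n::finite, 'i::finite, 'j::finite, 'k::finite) capacity_problem"
    and t :: "'i \<Rightarrow> nat"
    and xMLP :: "'n \<Rightarrow> real ^ 'i"
    and yMLP :: "'n \<Rightarrow> real ^ 'j"
    and \<delta> :: "'i \<Rightarrow> 'n \<Rightarrow> real"
  assumes "is_capacity_problem C"
    and "t \<in> revision_times C"
    and "MLP_optimal C xMLP yMLP"
    and "\<And>i n. \<delta> i n = (usage C n *v yMLP n) $ i"
  shows "V_ATS C t - V_ATS_opt C \<le>
    (\<Sum>i\<in>UNIV.
        v_R C (\<lambda>n. acq_cost C n $ i) (\<delta> i) (t i)
      - v_M C (\<lambda>n. acq_cost C n $ i) (\<delta> i)
      + Max ((\<lambda>D. of_int \<lceil>condensed_demand (\<delta> i) D\<rceil> - condensed_demand (\<delta> i) D)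
               ` condensed_nodes C (t i))
        * acq_cost C (root_node C) $ i)"
proof -
  have tree: "is_scenario_tree C"
    using assms(1) by (simp add: is_capacity_problem_def)
  have t: "1 \<le> t i" for i
    using assms(2) by (simp add: revision_times_def)
  define c where "c = (\<lambda>i n. acq_cost C n $ i)"
  have c_nonneg: "0 \<le> c i n" for i n
    using assms(1) by (simp add: c_def is_capacity_problem_def less_eq_vec_def)
  define b where "b = (\<Sum>n\<in>UNIV. prob C n * (alloc_cost C n \<bullet> yMLP n))"
  have \<delta>: "\<delta> i = (\<lambda>n. (usage C n *v yMLP n) $ i)" for i
    using assms(4) by auto
  have feasible: "MLP_feasible C xMLP yMLP"
    using assms(3) by (simp add: MLP_optimal_def)
  have near: "\<exists>x. ATS_feasible C t x yMLP \<and>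
      total_cost C x yMLP \<le> b + (\<Sum>i\<in>UNIV. v_R C (c i) (\<delta> i) (t i)
        + max_rounding_gap C (\<delta> i) (t i) * c i (root_node C) + \<epsilon>)" if "0 < \<epsilon>" for \<epsilon>
  proof -
    have "\<exists>w. single_LP_feasible C (\<delta> i) w \<and> adaptive C (t i) w \<and> (\<forall>n. w n \<in> \<int>) \<and>
      single_cost C (c i) w < v_R C (c i) (\<delta> i) (t i)
        + max_rounding_gap C (\<delta> i) (t i) * c i (root_node C) + \<epsilon>" for i
      using integral_plan_near_v_R[OF tree t that] by metis
    then obtain w where w: "\<And>i. single_LP_feasible C (\<delta> i) (w i)" "\<And>i. adaptive C (t i) (w i)"
      "\<And>i n. w i n \<in> \<int>"
      "\<And>i. single_cost C (c i) (w i) < v_R C (c i) (\<delta> i) (t i)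
        + max_rounding_gap C (\<delta> i) (t i) * c i (root_node C) + \<epsilon>"
      by metis
    define x where "x n = (\<chi> i. w i n)" for n
    have x: "x n $ i = w i n" for n i
      by (simp add: x_def)
    have "ATS_feasible C t x yMLP"
      using w feasible by (simp add: ATS_feasible_def MS_feasible_def MLP_feasible_iff x \<delta>)
    moreover have "total_cost C x yMLP = (\<Sum>i\<in>UNIV. single_cost C (c i) (w i)) + b"
      by (simp add: total_cost_split x b_def c_def)
    ultimately show ?thesis
      using sum_mono[of UNIV "\<lambda>i. single_cost C (c i) (w i)", OF less_imp_le[OF w(4)]]
      by (metis (no_types, lifting) add.commute add_left_mono)
  qed
  have "V_ATS C t \<le> total_cost C x yMLP" if "ATS_feasible C t x yMLP" for x
    unfolding V_ATS_def
  proof (rule cInf_lower)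
    show "bdd_below {total_cost C x y |x y. ATS_feasible C t x y}"
      using total_cost_nonneg[OF assms(1)]
      by (intro bdd_belowI[of _ 0]) (auto simp: ATS_feasible_def MS_feasible_def)
  qed (use that in blast)
  then have eps: "V_ATS C t \<le> b + (\<Sum>i\<in>UNIV. v_R C (c i) (\<delta> i) (t i)
      + max_rounding_gap C (\<delta> i) (t i) * c i (root_node C) + \<epsilon>)" if "0 < \<epsilon>" for \<epsilon>
    using near[OF that] order_trans by blast
  have upper: "V_ATS C t \<le> b + (\<Sum>i\<in>UNIV. v_R C (c i) (\<delta> i) (t i)
      + max_rounding_gap C (\<delta> i) (t i) * c i (root_node C))"
  proof (rule field_le_epsilon)
    fix \<epsilon> :: real
    assume "0 < \<epsilon>"
    then show "V_ATS C t \<le> b + (\<Sum>i\<in>UNIV. v_R C (c i) (\<delta> i) (t i)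
      + max_rounding_gap C (\<delta> i) (t i) * c i (root_node C)) + \<epsilon>"
      \<comment> \<open>Each resource brings its own error, so \<open>\<epsilon>\<close> is shared equally among the resources.\<close>
      using eps[of "\<epsilon> / of_nat CARD('i)"] by (simp add: sum.distrib)
  qed
  have "b + (\<Sum>i\<in>UNIV. v_M C (c i) (\<delta> i)) \<le> total_cost C xMLP yMLP"
    using feasible c_nonneg
    by (auto simp: total_cost_split b_def MLP_feasible_iff \<delta> c_def intro!: sum_mono v_M_le[OF tree])
  also have "\<dots> \<le> V_ATS_opt C"
    unfolding V_ATS_opt_def
  proof (rule cInf_greatest)
    show "{total_cost C x y |t x y. t \<in> revision_times C \<and> ATS_feasible C t x y} \<noteq> {}"
      using near[of 1] assms(2) by auto
  qed (use assms(3) in \<open>auto simp: MLP_optimal_def ATS_feasible_def MS_feasible_def\<close>)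
  finally show ?thesis
    using upper by (simp add: sum.distrib sum_subtractf c_def max_rounding_gap_def)
qed

end
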